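(* Let $n\ge0$ and $0\le s,r\le n$ be integers. For a prime power $q$ let $\varPhi_n(s,r)$ be the canonical matrix element of the pair $(\mathbb{F}^n,(\mathbb{F}^\times)^n\rtimes\mathfrak{S}_n)$ over the finite field $\mathbb{F}$ of order $q$. (1) $\varPhi_n(s,r)$ is a polynomial in $q$ with integer coefficients (i.e. there is a polynomial in $\mathbb{Z}[X]$, depending only on $n,s,r$, whose value at $X=q$ is $\varPhi_n(s,r)$ for every prime power $q$). (2) As $q\to1$ in this polynomial, $\varPhi_n(s,r)\to(-1)^r\binom sr$ if $r\le s$, and $\varPhi_n(s,r)\to0$ otherwise.
   Context: Let $\mathbb{F}$ be a finite field of order $q$ and $\theta$ a non-trivial additive character of $\mathbb{F}$. For $a\in\mathbb{F}^n$ let $\operatorname{wt}a$ be the number of non-zero coordinates of $a$ and let $\langle a|b\rangle=\sum_ja_jb_j$. The canonical matrix is $$\varPhi_n(s,r)=\sum_{b\in\mathbb{F}^n,\ \operatorname{wt}b=r}\overline{\theta(\langle a|b\rangle)},\qquad a\in\mathbb{F}^n\text{ any element with }\operatorname{wt}a=s$$ (independent of the choice of $a$); it is the matrix, in the bases of characteristic functions of orbits, of the Fourier transformation on functions on $\mathbb{F}^n$ invariant under the wreath product $(\mathbb{F}^\times)^n\rtimes\mathfrak{S}_n$. *)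

theory Defs
  imports Complex_Main "HOL-Library.FuncSet" "HOL-Algebra.Ring"
    "HOL-Computational_Algebra.Polynomial"
begin

definition nontrivial_additive_character ::
    "('a, 'm) ring_scheme \<Rightarrow> ('a \<Rightarrow> complex) \<Rightarrow> bool" where
  "nontrivial_additive_character F \<theta> \<longleftrightarrow>
     (\<forall>x\<in>carrier F. \<theta> x \<noteq> 0) \<and>
     (\<forall>x\<in>carrier F. \<forall>y\<in>carrier F. \<theta> (x \<oplus>\<^bsub>F\<^esub> y) = \<theta> x * \<theta> y) \<and>
     (\<exists>x\<in>carrier F. \<theta> x \<noteq> 1)"

definition vectors :: "('a, 'm) ring_scheme \<Rightarrow> nat \<Rightarrow> (nat \<Rightarrow> 'a) set" where
  "vectors F n = {..<n} \<rightarrow>\<^sub>E carrier F"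

definition wt :: "('a, 'm) ring_scheme \<Rightarrow> nat \<Rightarrow> (nat \<Rightarrow> 'a) \<Rightarrow> nat" where
  "wt F n a = card {j \<in> {..<n}. a j \<noteq> \<zero>\<^bsub>F\<^esub>}"

definition pairing ::
    "('a, 'm) ring_scheme \<Rightarrow> nat \<Rightarrow> (nat \<Rightarrow> 'a) \<Rightarrow> (nat \<Rightarrow> 'a) \<Rightarrow> 'a" where
  "pairing F n a b = (\<Oplus>\<^bsub>F\<^esub>j\<in>{..<n}. a j \<otimes>\<^bsub>F\<^esub> b j)"

(* The entry in the row of the orbit of a: Phi_n(s,r) is the value at any vector a of weight s.
   No representative is chosen here; statements quantify over all a with wt F n a = s. *)
definition canonical_entry ::
    "('a, 'm) ring_scheme \<Rightarrow> ('a \<Rightarrow> complex) \<Rightarrow> nat \<Rightarrow> (nat \<Rightarrow> 'a) \<Rightarrow> nat \<Rightarrow> complex" where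
  "canonical_entry F \<theta> n a r =
     (\<Sum>b\<in>{b \<in> vectors F n. wt F n b = r}. cnj (\<theta> (pairing F n a b)))"

(* P evaluates to Phi_n(s,r) at the order of every finite field with elements in the type 'a.
   HOL cannot quantify over types inside a formula. Up to isomorphism every finite field has
   its elements in nat, so the instance at nat covers all prime powers and already determines P
   from n, s, r; the instance at another type says that the same P serves the fields there. *)
definition canonical_polynomial ::
    "'a itself \<Rightarrow> nat \<Rightarrow> nat \<Rightarrow> nat \<Rightarrow> int poly \<Rightarrow> bool" where
  "canonical_polynomial _ n s r P \<longleftrightarrow>
     (\<forall>(F :: 'a ring) \<theta> a.
        field F \<longrightarrow> finite (carrier F) \<longrightarrow> nontrivial_additive_character F \<theta> \<longrightarrow>
        a \<in> vectors F n \<longrightarrow> wt F n a = s \<longrightarrow>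
        canonical_entry F \<theta> n a r = of_int (poly P (int (card (carrier F)))))"

end

theory Submission imports Defs begin

text \<open>
  The generating polynomial of the entries in a row factors over the coordinates:
  $\sum_b \overline{\theta(\langle a|b\rangle)} X^{wt(b)}
    = \prod_j \sum_x \overline{\theta(a_j x)} X^{[x \neq 0]} = (1-X)^s (1+(q-1)X)^{n-s}$,
  because a non-trivial character sums to zero over the field.
\<close>

text \<open>The Krawtchouk polynomial, read as a polynomial in q, with \<open>[:-1, 1:]\<close>
  standing for q - 1. It is the coefficient of X^r in the generating product; the index i is the
  part of r taken from (1-X)^s. Integrality in q is built in.\<close>

definition krawtchouk_poly :: "nat \<Rightarrow> nat \<Rightarrow> nat \<Rightarrow> int poly" where
  "krawtchouk_poly n s r =
     (\<Sum>i\<le>r. smult ((-1) ^ i * int (s choose i) * int ((n - s) choose (r - i)))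
                ([:-1, 1:] ^ (r - i)))"

lemma poly_krawtchouk_poly:
  "poly (krawtchouk_poly n s r) q =
     (\<Sum>i\<le>r. (-1) ^ i * int (s choose i) * int ((n - s) choose (r - i)) * (q - 1) ^ (r - i))"
  by (simp add: krawtchouk_poly_def poly_sum algebra_simps)

lemma poly_krawtchouk_poly_1:
  "poly (krawtchouk_poly n s r) 1 = (-1) ^ r * int (s choose r)"
proof -
  \<comment> \<open>At q = 1 the factor (q-1)^(r-i) is a power of 0, so only i = r survives, with
    0^0 = 1.\<close>
  have "poly (krawtchouk_poly n s r) 1 =
          (\<Sum>i\<le>r. if i = r then (-1) ^ i * int (s choose i) else 0)"
    unfolding poly_krawtchouk_poly by (rule sum.cong) (auto simp: power_0_left)
  then show ?thesis
    by simp
qed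

lemma coeff_one_linear_poly_power:
  fixes c :: "'a :: comm_ring_1"
  shows "coeff ([:1, c:] ^ m) i = of_nat (m choose i) * c ^ i"
proof (cases "i \<le> m")
  case False
  \<comment> \<open>Above the degree both sides vanish: the coefficient by the degree bound, the
    binomial since m < i.\<close>
  have "degree ([:1, c:] ^ m) \<le> degree [:1, c:] * m"
    by (rule degree_power_le)
  also have "\<dots> \<le> m"
    by simp
  also have "m < i"
    using False by simp
  finally show ?thesis
    using False by (simp add: coeff_eq_0 binomial_eq_0)
qed (simp add: coeff_linear_poly_power)

lemma coeff_generating_product:
  "coeff ([:1, -1:] ^ s * [:1, of_int q - 1:] ^ (n - s)) r =
     (of_int (poly (krawtchouk_poly n s r) q) :: 'a :: comm_ring_1)"
  by (simp add: coeff_mult coeff_one_linear_poly_power poly_krawtchouk_poly mult_ac)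

lemma poly_map_poly_of_int:
  "poly (map_poly real_of_int P) (of_int x) = of_int (poly P x)"
  by (simp add: poly_altdef coeff_map_poly degree_map_poly)

text \<open>Exponents add under multiplication; this turns the 0/1 exponents of the coordinates into
  the weight of a vector.\<close>

lemma prod_monom:
  fixes c :: "'i \<Rightarrow> 'a :: comm_semiring_1"
  assumes "finite A"
  shows "(\<Prod>i\<in>A. monom (c i) (e i)) = monom (\<Prod>i\<in>A. c i) (\<Sum>i\<in>A. e i)"
  using assms by (induction A rule: finite_induct) (simp_all add: mult_monom)

locale finite_field_character = field F for F :: "('a, 'm) ring_scheme" (structure) +
  fixes \<theta> :: "'a \<Rightarrow> complex"
  assumes finite_carrier: "finite (carrier F)"
    and character: "nontrivial_additive_character F \<theta>"
begin

lemma character_nonzero: "x \<in> carrier F \<Longrightarrow> \<theta> x \<noteq> 0"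
  and character_add: "x \<in> carrier F \<Longrightarrow> y \<in> carrier F \<Longrightarrow> \<theta> (x \<oplus> y) = \<theta> x * \<theta> y"
  using character unfolding nontrivial_additive_character_def by auto

lemma character_zero: "\<theta> \<zero> = 1"
  using character_add[of \<zero> \<zero>] character_nonzero[of \<zero>] by simp

lemma character_finsum:
  assumes "finite A" "f \<in> A \<rightarrow> carrier F"
  shows "\<theta> (\<Oplus>i\<in>A. f i) = (\<Prod>i\<in>A. \<theta> (f i))"
  using assms
  by (induction A rule: finite_induct) (simp_all add: character_zero character_add Pi_iff)

text \<open>Translation by some y with \<open>\<theta> y\<close> different from 1 permutes the
  field, yet multiplies the sum by \<open>\<theta> y\<close>.\<close>

lemma sum_character: "(\<Sum>x\<in>carrier F. \<theta> x) = 0"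
proof -
  obtain y where y: "y \<in> carrier F" "\<theta> y \<noteq> 1"
    using character unfolding nontrivial_additive_character_def by auto
  have inj: "inj_on (\<lambda>x. y \<oplus> x) (carrier F)"
    using y(1) by (auto intro!: inj_onI)
  \<comment> \<open>An injective self-map of a finite set is onto.\<close>
  moreover have "(\<lambda>x. y \<oplus> x) ` carrier F = carrier F"
    using y(1) inj finite_carrier by (intro endo_inj_surj) auto
  ultimately have "(\<Sum>x\<in>carrier F. \<theta> x) = (\<Sum>x\<in>carrier F. \<theta> (y \<oplus> x))"
    using sum.reindex[of "\<lambda>x. y \<oplus> x" "carrier F" \<theta>] by (simp add: o_def)
  also have "\<dots> = \<theta> y * (\<Sum>x\<in>carrier F. \<theta> x)"
    using y(1) by (simp add: character_add sum_distrib_left)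
  finally show ?thesis
    using y(2) by simp
qed

text \<open>Multiplication by c permutes the field, so the sum is that of
  \<open>sum_character\<close>.\<close>

lemma sum_character_mult:
  assumes "c \<in> carrier F" "c \<noteq> \<zero>"
  shows "(\<Sum>x\<in>carrier F. \<theta> (c \<otimes> x)) = 0"
proof -
  have inj: "inj_on (\<lambda>x. c \<otimes> x) (carrier F)"
    using assms by (auto intro!: inj_onI simp: m_lcancel)
  moreover have "(\<lambda>x. c \<otimes> x) ` carrier F = carrier F"
    using assms inj finite_carrier by (intro endo_inj_surj) auto
  ultimately show ?thesis
    using sum.reindex[of "\<lambda>x. c \<otimes> x" "carrier F" \<theta>] sum_character by (simp add: o_def)
qed

text \<open>The form \<open>of_int (int ...)\<close> matches
  \<open>coeff_generating_product\<close>, where q is an integer.\<close>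

lemma coordinate_factor:
  assumes "c \<in> carrier F"
  shows "(\<Sum>x\<in>carrier F. monom (cnj (\<theta> (c \<otimes> x))) (if x \<noteq> \<zero> then 1 else 0)) =
    (if c \<noteq> \<zero> then [:1, -1:] else [:1, of_int (int (card (carrier F))) - 1:])"
proof -
  let ?q = "of_nat (card (carrier F)) :: complex"
  have split: "(\<Sum>x\<in>carrier F. f x) = f \<zero> + (\<Sum>x\<in>carrier F - {\<zero>}. f x)"
    for f :: "'a \<Rightarrow> 'b :: comm_monoid_add"
    using finite_carrier by (simp add: sum.remove)
  \<comment> \<open>The element 0 gives the constant term 1, and \<open>S\<close> is the coefficient
    of X. It is found from the full character sum 1 + \<open>S\<close>, which is 0 or q.\<close>
  define S where "S = (\<Sum>x\<in>carrier F - {\<zero>}. cnj (\<theta> (c \<otimes> x)))"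
  have "1 + S = cnj (\<Sum>x\<in>carrier F. \<theta> (c \<otimes> x))"
    using split[of "\<lambda>x. cnj (\<theta> (c \<otimes> x))"] assms by (simp add: S_def character_zero)
  moreover have "(\<Sum>x\<in>carrier F. \<theta> (c \<otimes> x)) = (if c \<noteq> \<zero> then 0 else ?q)"
    using assms sum_character_mult by (simp add: character_zero)
  ultimately have S: "S = (if c \<noteq> \<zero> then -1 else ?q - 1)"
    by (auto simp: algebra_simps eq_neg_iff_add_eq_0)
  have "(\<Sum>x\<in>carrier F. monom (cnj (\<theta> (c \<otimes> x))) (if x \<noteq> \<zero> then 1 else 0)) =
          monom 1 0 + (\<Sum>x\<in>carrier F - {\<zero>}. monom (cnj (\<theta> (c \<otimes> x))) 1)"
    using split[of "\<lambda>x. monom (cnj (\<theta> (c \<otimes> x))) (if x \<noteq> \<zero> then 1 else 0)"] assms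
    by (simp add: character_zero cong: sum.cong_simp)
  also have "\<dots> = monom 1 0 + monom S 1"
    by (simp add: S_def monom_sum)
  also have "\<dots> = [:1, S:]"
    by (simp add: monom_0 monom_Suc)
  finally show ?thesis
    using S by simp
qed

lemma generating_polynomial:
  assumes "a \<in> vectors F n"
  shows "(\<Sum>b\<in>vectors F n. monom (cnj (\<theta> (pairing F n a b))) (wt F n b)) =
    [:1, -1:] ^ wt F n a * [:1, of_int (int (card (carrier F))) - 1:] ^ (n - wt F n a)"
proof -
  have a: "a j \<in> carrier F" if "j < n" for j
    using assms that by (auto simp: vectors_def PiE_iff)
  \<comment> \<open>The character turns the pairing into a product over coordinates, and the weight
    is a sum of indicators, so each monomial splits coordinatewise.\<close>
  have term_eq: "monom (cnj (\<theta> (pairing F n a b))) (wt F n b) =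
      (\<Prod>j<n. monom (cnj (\<theta> (a j \<otimes> b j))) (if b j \<noteq> \<zero> then 1 else 0))"
    if b: "b \<in> vectors F n" for b
  proof -
    have "\<theta> (pairing F n a b) = (\<Prod>j<n. \<theta> (a j \<otimes> b j))"
      unfolding pairing_def using a b
      by (intro character_finsum) (auto simp: vectors_def PiE_iff)
    moreover have "wt F n b = (\<Sum>j<n. if b j \<noteq> \<zero> then 1 else 0)"
      by (simp add: wt_def sum.If_cases Int_def)
    ultimately show ?thesis
      by (simp add: prod_monom)
  qed
  have zeros: "card ({..<n} \<inter> - {j. a j \<noteq> \<zero>}) = n - wt F n a"
  proof -
    have "{..<n} \<inter> - {j. a j \<noteq> \<zero>} = {..<n} - {j \<in> {..<n}. a j \<noteq> \<zero>}"
      by auto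
    then show ?thesis
      by (simp add: wt_def card_Diff_subset subset_eq)
  qed
  \<comment> \<open>Distributivity: choosing one summand x for each j < n is the same as choosing a
    vector b.\<close>
  have "(\<Sum>b\<in>vectors F n. monom (cnj (\<theta> (pairing F n a b))) (wt F n b)) =
      (\<Prod>j<n. \<Sum>x\<in>carrier F. monom (cnj (\<theta> (a j \<otimes> x))) (if x \<noteq> \<zero> then 1 else 0))"
    using finite_carrier by (simp add: prod_sum_PiE term_eq vectors_def cong: sum.cong)
  also have "\<dots> = (\<Prod>j<n. if a j \<noteq> \<zero> then [:1, -1:]
                          else [:1, of_int (int (card (carrier F))) - 1:])"
    using a by (intro prod.cong refl coordinate_factor) auto
  also have "\<dots> =
      [:1, -1:] ^ wt F n a * [:1, of_int (int (card (carrier F))) - 1:] ^ (n - wt F n a)"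
    by (subst prod.If_cases)
      (simp_all only: prod_constant zeros finite_lessThan, simp add: wt_def Int_def)
  finally show ?thesis .
qed

lemma canonical_entry_eq_krawtchouk_poly:
  assumes "a \<in> vectors F n"
  shows "canonical_entry F \<theta> n a r =
    of_int (poly (krawtchouk_poly n (wt F n a) r) (int (card (carrier F))))"
proof -
  have "finite (vectors F n)"
    using finite_carrier by (simp add: vectors_def finite_PiE)
  \<comment> \<open>The coefficient of X^r keeps exactly the vectors of weight r.\<close>
  then have "canonical_entry F \<theta> n a r =
      coeff (\<Sum>b\<in>vectors F n. monom (cnj (\<theta> (pairing F n a b))) (wt F n b)) r"
    by (simp add: canonical_entry_def coeff_sum sum.If_cases Int_def)
  then show ?thesis
    using assms by (simp only: generating_polynomial coeff_generating_product)
qed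

end

text \<open>The witness depends only on n, s, r and the element type is arbitrary here, so one
  polynomial serves both instances in the theorem.\<close>

lemma canonical_polynomial_krawtchouk_poly:
  "canonical_polynomial TYPE('a) n s r (krawtchouk_poly n s r)"
  unfolding canonical_polynomial_def
  using finite_field_character.canonical_entry_eq_krawtchouk_poly
  by (fastforce simp: finite_field_character_def finite_field_character_axioms_def)

theorem corollary5p1p2:
  fixes n s r :: nat
  assumes "s \<le> n" and "r \<le> n"
  shows "\<exists>P :: int poly.
           canonical_polynomial TYPE(nat) n s r P \<and>
           canonical_polynomial TYPE('a) n s r P \<and>
           ((\<lambda>x :: real. poly (map_poly real_of_int P) x) \<longlongrightarrow>
              (if r \<le> s then (-1) ^ r * real (s choose r) else 0)) (at 1)"
proof (intro exI conjI)
  let ?P = "krawtchouk_poly n s r"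
  have "poly (map_poly real_of_int ?P) 1 = (-1) ^ r * real (s choose r)"
    using poly_map_poly_of_int[of ?P 1] by (simp add: poly_krawtchouk_poly_1)
  \<comment> \<open>For r > s the binomial \<open>s choose r\<close> is already 0, which accounts
    for the second branch.\<close>
  then have limit: "poly (map_poly real_of_int ?P) 1 =
      (if r \<le> s then (-1) ^ r * real (s choose r) else 0)"
    by simp
  show "((\<lambda>x. poly (map_poly real_of_int ?P) x) \<longlongrightarrow>
      (if r \<le> s then (-1) ^ r * real (s choose r) else 0)) (at 1)"
    \<comment> \<open>With the limit rewritten as the value at 1, the claim is continuity of a real
      polynomial.\<close>
    unfolding limit[symmetric] by (intro tendsto_poly tendsto_ident_at)
qed (rule canonical_polynomial_krawtchouk_poly)+

end
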